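(* Let $\varphi_e$ and $\varphi_{e_1}$ be two ruled surfaces in $\mathbb{R}^3$ that form a Bertrand surface offset, with dual offset angle $\bar\theta=\theta+\varepsilon\theta^*$. Then the dual arc-length parameters $\bar s$ of $\varphi_e$ and $\bar s_1$ of $\varphi_{e_1}$ satisfy $$\frac{d\bar s_1}{d\bar s}=\cos\bar\theta+\bar\gamma\,\sin\bar\theta .$$
   Context: Dual numbers are $\bar a=a+\varepsilon a^*$ with $a,a^*\in\mathbb{R}$, $\varepsilon\neq 0$, $\varepsilon^2=0$. For a differentiable real function $f$, $f(x+\varepsilon x^* )=f(x)+\varepsilon x^*f'(x)$; e.g. $\cos(x+\varepsilon x^* )=\cos x-\varepsilon x^*\sin x$, $\sin(x+\varepsilon x^* )=\sin x+\varepsilon x^*\cos x$. Dual vectors are $\tilde a=\vec a+\varepsilon\vec a^*$ with $\vec a,\vec a^*\in\mathbb{R}^3$; scalar and vector products are extended $\varepsilon$-bilinearly. A ruled surface $\varphi_e=\vec c(s)+v\,\vec e(s)$ (all data smooth) is parametrized so that $\langle \vec e,\vec e\rangle=1$, $\langle \vec e',\vec e'\rangle=1$, $\langle \vec c',\vec e'\rangle=0$, where prime is $d/ds$; so $s$ is the arc length of the real indicatrix $\vec e(s)$ and $\vec c$ is the striction line. It is represented by the dual unit vector $\tilde e=\vec e+\varepsilon\,\vec c\times\vec e$. Put $\vec t=\vec e'$, $\vec g=\vec e\times\vec t$; the conical curvature $\gamma$ is defined by $\vec e'=\vec t$, $\vec t'=\gamma\vec g-\vec e$, $\vec g'=-\gamma\vec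 t$. Put $\Delta=\det(\vec c',\vec e,\vec t)$, $\delta=\langle\vec c',\vec e\rangle$. The dual Darboux frame is $\{\tilde e,\tilde t,\tilde g\}$ with $\tilde t=\vec t+\varepsilon\,\vec c\times\vec t$, $\tilde g=\vec g+\varepsilon\,\vec c\times\vec g$. The dual arc-length is $\bar s=s+\varepsilon\int_0^s\Delta\,du$, so $d\bar s/ds=1+\varepsilon\Delta$ and $d/d\bar s=(1+\varepsilon\Delta)^{-1}d/ds$. The dual conical curvature is $\bar\gamma=\gamma+\varepsilon(\delta-\gamma\Delta)$, and $d\tilde e/d\bar s=\tilde t$, $d\tilde t/d\bar s=\bar\gamma\tilde g-\tilde e$, $d\tilde g/d\bar s=-\bar\gamma\tilde t$. The corresponding objects of a second ruled surface $\varphi_{e_1}$ (with its own parameter $s_1$) carry the subscript $1$. $\varphi_e$ and $\varphi_{e_1}$ form a Bertrand surface offset if, under a correspondence $s_1=s_1(s)$ between their rulings (differentiable with nonvanishing derivative), $\tilde t=\tilde t_1$ at corresponding parameters. The frames are then related by $\tilde e_1=\cos\bar\theta\,\tilde e-\sin\bar\theta\,\tilde g$, $\tilde t_1=\tilde t$, $\tilde g_1=\sin\bar\theta\,\tilde e+\cos\bar\theta\,\tilde g$, where $\bar\theta=\theta+\varepsilon\theta^*$ ($0\le\theta\le\pi$, $\theta^*\in\mathbb{R}$) is the dual angle between $\tilde e$ and $\tilde e_1$, called the dual offset angle; $\theta$ is the offset angle and $\theta^*$ the offset distance. The derivative $d\bar s_1/d\bar s$ means $(d\bar s_1/ds)/(d\bar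 s/ds)$. *)

theory Defs
  imports "HOL-Analysis.Analysis"
begin

unbundle cross3_syntax

section \<open>Dual numbers and dual vectors\<close>

text \<open>\<open>Dual a b\<close> is \<open>a + \<epsilon> b\<close>. The type \<open>real dual\<close> is the ring of dual numbers;
  \<open>(real^3) dual\<close> is the space of dual vectors.\<close>

datatype 'a dual = Dual (real_part: 'a) (dual_part: 'a)

instantiation dual :: (real_normed_vector) real_normed_vector
begin

definition "0 = Dual 0 0"
definition "x + y = Dual (real_part x + real_part y) (dual_part x + dual_part y)"
definition "- x = Dual (- real_part x) (- dual_part x)"
definition "x - y = Dual (real_part x - real_part y) (dual_part x - dual_part y)"
definition "r *\<^sub>R x = Dual (r *\<^sub>R real_part x) (r *\<^sub>R dual_part x)"
definition "norm x = norm (real_part x, dual_part x)" for x :: "'a dual"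
definition "sgn x = inverse (norm x) *\<^sub>R x" for x :: "'a dual"
definition "dist x y = norm (x - y)" for x y :: "'a dual"
definition uniformity_dual :: "('a dual \<times> 'a dual) filter"
  where "uniformity_dual = (INF e\<in>{0 <..}. principal {(x, y). dist x y < e})"
definition open_dual :: "'a dual set \<Rightarrow> bool"
  where "open_dual U \<longleftrightarrow> (\<forall>x\<in>U. eventually (\<lambda>(x', y). x' = x \<longrightarrow> y \<in> U) uniformity)"

instance
proof
  fix a b :: real and x y z :: "'a dual" and U :: "'a dual set"
  show "x + y + z = x + (y + z)" "x + y = y + x" "0 + x = x" "- x + x = 0" "x - y = x + - y"
    by (simp_all add: plus_dual_def zero_dual_def uminus_dual_def minus_dual_def add_ac)
  show "a *\<^sub>R (x + y) = a *\<^sub>R x + a *\<^sub>R y" "(a + b) *\<^sub>R x = a *\<^sub>R x + b *\<^sub>R x"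
    "a *\<^sub>R b *\<^sub>R x = (a * b) *\<^sub>R x" "1 *\<^sub>R x = x"
    by (simp_all add: plus_dual_def scaleR_dual_def algebra_simps)
  show "sgn x = inverse (norm x) *\<^sub>R x" "dist x y = norm (x - y)"
    by (simp_all add: sgn_dual_def dist_dual_def)
  show "uniformity = (INF e\<in>{0 <..}. principal {(x, y::'a dual). dist x y < e})"
    by (rule uniformity_dual_def)
  show "open U = (\<forall>x\<in>U. \<forall>\<^sub>F (x', y) in uniformity. x' = x \<longrightarrow> y \<in> U)"
    by (rule open_dual_def)
  show "(norm x = 0) = (x = 0)"
    by (cases x) (simp add: norm_dual_def zero_dual_def zero_prod_def)
  show "norm (x + y) \<le> norm x + norm y"
    using norm_triangle_ineq[of "(real_part x, dual_part x)" "(real_part y, dual_part y)"]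
    by (simp add: norm_dual_def plus_dual_def)
  show "norm (a *\<^sub>R x) = \<bar>a\<bar> * norm x"
    using norm_scaleR[of a "(real_part x, dual_part x)"]
    by (simp add: norm_dual_def scaleR_dual_def)
qed

end

instantiation dual :: (real_normed_field) comm_ring_1
begin

definition "1 = Dual 1 0"
definition "x * y = Dual (real_part x * real_part y)
  (real_part x * dual_part y + dual_part x * real_part y)"

instance
  by standard (auto simp: one_dual_def times_dual_def plus_dual_def zero_dual_def algebra_simps)

end

text \<open>The inverse of \<open>a + \<epsilon> b\<close> with \<open>a \<noteq> 0\<close>; it has no meaning when \<open>a = 0\<close>.\<close>

instantiation dual :: (real_normed_field) inverse
begin

definition "inverse x = Dual (inverse (real_part x)) (- (dual_part x / (real_part x)\<^sup>2))"
definition "x div y = x * inverse y" for x y :: "'a dual"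

instance ..

end

lemma dual_mult_inverse:
  fixes x :: "'a::real_normed_field dual"
  assumes "real_part x \<noteq> 0"
  shows "x * inverse x = 1"
  using assms by (simp add: times_dual_def inverse_dual_def one_dual_def power2_eq_square divide_inverse)

definition dual_scale :: "real dual \<Rightarrow> (real^3) dual \<Rightarrow> (real^3) dual" (infixr \<open>*\<^sub>D\<close> 75)
  where "a *\<^sub>D x = Dual (real_part a *\<^sub>R real_part x)
    (real_part a *\<^sub>R dual_part x + dual_part a *\<^sub>R real_part x)"

definition dual_extension :: "(real \<Rightarrow> real) \<Rightarrow> real dual \<Rightarrow> real dual"
  where "dual_extension f x = Dual (f (real_part x)) (dual_part x * deriv f (real_part x))"

definition dcos :: "real dual \<Rightarrow> real dual" where "dcos = dual_extension cos"

definition dsin :: "real dual \<Rightarrow> real dual" where "dsin = dual_extension sin"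

lemma dcos_Dual: "dcos (Dual x y) = Dual (cos x) (- (y * sin x))"
proof -
  have "deriv cos x = - sin x" by (rule DERIV_imp_deriv) (rule DERIV_cos)
  then show ?thesis by (simp add: dcos_def dual_extension_def)
qed

lemma dsin_Dual: "dsin (Dual x y) = Dual (sin x) (y * cos x)"
proof -
  have "deriv sin x = cos x" by (rule DERIV_imp_deriv) (rule DERIV_sin)
  then show ?thesis by (simp add: dsin_def dual_extension_def)
qed

text \<open>\<open>df/dg = D\<close> at \<open>s\<close> for dual-valued functions \<open>f\<close> and \<open>g\<close> of the same real parameter,
  meaning \<open>(df/ds) / (dg/ds) = D\<close> where both derivatives exist and the denominator is invertible.\<close>

definition has_derivative_wrt ::
    "(real \<Rightarrow> real dual) \<Rightarrow> (real \<Rightarrow> real dual) \<Rightarrow> real dual \<Rightarrow> real \<Rightarrow> bool"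
  where "has_derivative_wrt f g D s \<longleftrightarrow>
    (\<exists>f' g'. (f has_vector_derivative f') (at s) \<and> (g has_vector_derivative g') (at s) \<and>
      real_part g' \<noteq> 0 \<and> f' / g' = D)"

section \<open>Ruled surfaces\<close>

definition smooth_on :: "real set \<Rightarrow> (real \<Rightarrow> 'a::real_normed_vector) \<Rightarrow> bool"
  where "smooth_on I f \<longleftrightarrow>
    (\<forall>n. \<forall>s\<in>I. ((\<lambda>h u. vector_derivative h (at u)) ^^ n) f differentiable (at s))"

definition tvec :: "(real \<Rightarrow> real^3) \<Rightarrow> real \<Rightarrow> real^3"
  where "tvec e s = vector_derivative e (at s)"

definition gvec :: "(real \<Rightarrow> real^3) \<Rightarrow> real \<Rightarrow> real^3"
  where "gvec e s = e s \<times> tvec e s"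

text \<open>The base curve \<open>c\<close> is the striction line, and the parameter is the arc length of the
  spherical indicatrix \<open>e\<close>. The parameter interval contains \<open>0\<close>, the base point of the
  dual arc length.\<close>

definition ruled_surface ::
    "real set \<Rightarrow> (real \<Rightarrow> real \<Rightarrow> real^3) \<Rightarrow> (real \<Rightarrow> real^3) \<Rightarrow> (real \<Rightarrow> real^3) \<Rightarrow> bool"
  where "ruled_surface I \<phi> c e \<longleftrightarrow>
    open I \<and> is_interval I \<and> 0 \<in> I \<and> smooth_on I c \<and> smooth_on I e \<and>
    (\<forall>s\<in>I. (\<forall>v. \<phi> s v = c s + v *\<^sub>R e s) \<and>
      e s \<bullet> e s = 1 \<and>
      vector_derivative e (at s) \<bullet> vector_derivative e (at s) = 1 \<and>
      vector_derivative c (at s) \<bullet> vector_derivative e (at s) = 0)"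

definition conical_curvature :: "real set \<Rightarrow> (real \<Rightarrow> real^3) \<Rightarrow> (real \<Rightarrow> real) \<Rightarrow> bool"
  where "conical_curvature I e \<gamma> \<longleftrightarrow> (\<forall>s\<in>I.
    (tvec e has_vector_derivative (\<gamma> s *\<^sub>R gvec e s - e s)) (at s) \<and>
    (gvec e has_vector_derivative (- \<gamma> s *\<^sub>R tvec e s)) (at s))"

definition Delta :: "(real \<Rightarrow> real^3) \<Rightarrow> (real \<Rightarrow> real^3) \<Rightarrow> real \<Rightarrow> real"
  where "Delta c e s = det (vector [vector_derivative c (at s), e s, tvec e s] :: real^3^3)"

definition delta :: "(real \<Rightarrow> real^3) \<Rightarrow> (real \<Rightarrow> real^3) \<Rightarrow> real \<Rightarrow> real"
  where "delta c e s = vector_derivative c (at s) \<bullet> e s"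

text \<open>The dual vector \<open>x + \<epsilon> (p \<times> x)\<close> of the oriented line through \<open>p\<close> with direction \<open>x\<close>.\<close>

definition dual_line :: "real^3 \<Rightarrow> real^3 \<Rightarrow> (real^3) dual"
  where "dual_line p x = Dual x (p \<times> x)"

definition dual_e :: "(real \<Rightarrow> real^3) \<Rightarrow> (real \<Rightarrow> real^3) \<Rightarrow> real \<Rightarrow> (real^3) dual"
  where "dual_e c e s = dual_line (c s) (e s)"

definition dual_t :: "(real \<Rightarrow> real^3) \<Rightarrow> (real \<Rightarrow> real^3) \<Rightarrow> real \<Rightarrow> (real^3) dual"
  where "dual_t c e s = dual_line (c s) (tvec e s)"

definition dual_g :: "(real \<Rightarrow> real^3) \<Rightarrow> (real \<Rightarrow> real^3) \<Rightarrow> real \<Rightarrow> (real^3) dual"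
  where "dual_g c e s = dual_line (c s) (gvec e s)"

text \<open>The interval integral is oriented, so negative \<open>s\<close> is covered.\<close>

definition dual_arc_length :: "(real \<Rightarrow> real^3) \<Rightarrow> (real \<Rightarrow> real^3) \<Rightarrow> real \<Rightarrow> real dual"
  where "dual_arc_length c e s = Dual s (LBINT u=ereal 0..ereal s. Delta c e u)"

definition dual_conical_curvature ::
    "(real \<Rightarrow> real^3) \<Rightarrow> (real \<Rightarrow> real^3) \<Rightarrow> (real \<Rightarrow> real) \<Rightarrow> real \<Rightarrow> real dual"
  where "dual_conical_curvature c e \<gamma> s = Dual (\<gamma> s) (delta c e s - \<gamma> s * Delta c e s)"

section \<open>Bertrand surface offsets\<close>

text \<open>The ruling \<open>s\<close> of the first surface corresponds to the ruling \<open>\<sigma> s\<close> of the second.\<close>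

definition bertrand_offset ::
    "real set \<Rightarrow> (real \<Rightarrow> real^3) \<Rightarrow> (real \<Rightarrow> real^3) \<Rightarrow>
     real set \<Rightarrow> (real \<Rightarrow> real^3) \<Rightarrow> (real \<Rightarrow> real^3) \<Rightarrow> (real \<Rightarrow> real) \<Rightarrow> bool"
  where "bertrand_offset I c e I\<^sub>1 c\<^sub>1 e\<^sub>1 \<sigma> \<longleftrightarrow>
    bij_betw \<sigma> I I\<^sub>1 \<and>
    (\<forall>s\<in>I. \<exists>d. (\<sigma> has_real_derivative d) (at s) \<and> d \<noteq> 0) \<and>
    (\<forall>s\<in>I. dual_t c\<^sub>1 e\<^sub>1 (\<sigma> s) = dual_t c e s)"

text \<open>The dual angle is oriented: the minus sign in front of \<open>dsin\<close> selects one of the two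
  dual unit vectors making the angle \<open>\<theta> s\<close> with \<open>dual_e c e s\<close>. For a Bertrand offset the
  relation \<open>dual_g c\<^sub>1 e\<^sub>1 (\<sigma> s) = dsin (\<theta> s) *\<^sub>D dual_e c e s + dcos (\<theta> s) *\<^sub>D dual_g c e s\<close>
  follows by taking the dual vector product with the common \<open>dual_t\<close>. The angle may depend on
  \<open>s\<close>; its constancy is not part of the definition.\<close>

definition dual_offset_angle ::
    "real set \<Rightarrow> (real \<Rightarrow> real^3) \<Rightarrow> (real \<Rightarrow> real^3) \<Rightarrow>
     (real \<Rightarrow> real^3) \<Rightarrow> (real \<Rightarrow> real^3) \<Rightarrow> (real \<Rightarrow> real) \<Rightarrow> (real \<Rightarrow> real dual) \<Rightarrow> bool"
  where "dual_offset_angle I c e c\<^sub>1 e\<^sub>1 \<sigma> \<theta> \<longleftrightarrow> (\<forall>s\<in>I.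
    0 \<le> real_part (\<theta> s) \<and> real_part (\<theta> s) \<le> pi \<and>
    dual_e c\<^sub>1 e\<^sub>1 (\<sigma> s) = dcos (\<theta> s) *\<^sub>D dual_e c e s - dsin (\<theta> s) *\<^sub>D dual_g c e s)"

end

theory Submission
  imports Defs
begin

text \<open>
  The formula is the derivative of one orthogonality relation. Along a Bertrand offset the dual
  vectors \<open>dual_e c\<^sub>1 e\<^sub>1 (\<sigma> s)\<close> and \<open>dual_t c e s = dual_t c\<^sub>1 e\<^sub>1 (\<sigma> s)\<close> belong to the same Darboux
  frame, so their dual scalar product vanishes identically in \<open>s\<close>. Writing \<open>S = 1 + \<epsilon> \<Delta>\<close> for the
  derivative of the dual arc length and \<open>S\<^sub>1 = \<sigma>' (1 + \<epsilon> \<Delta>\<^sub>1)\<close> for that of its counterpart along \<open>\<sigma>\<close>, and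
  abbreviating the dual vectors by \<open>e\<close>, \<open>t\<close>, \<open>g\<close>, \<open>e\<^sub>1\<close> and the dual conical curvature by \<open>\<gamma>\<close>,
  the dual Frenet equations \<open>e\<^sub>1' = S\<^sub>1 t\<close> and \<open>t' = S (\<gamma> g - e)\<close> turn the differentiated relation into
  \<open>S\<^sub>1 (t \<bullet> t) + S (\<gamma> (e\<^sub>1 \<bullet> g) - e\<^sub>1 \<bullet> e) = 0\<close>. Here \<open>t \<bullet> t = 1\<close>, and the offset relation gives
  \<open>e\<^sub>1 \<bullet> e = cos \<theta>\<close> and \<open>e\<^sub>1 \<bullet> g = - sin \<theta>\<close>, so \<open>S\<^sub>1 = S (cos \<theta> + \<gamma> sin \<theta>)\<close>.

  The Frenet equations are \<open>has_vector_derivative_dual_e\<close> and \<open>has_vector_derivative_dual_t\<close>; the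
  dual parts come down to resolving \<open>c' \<times> e\<close> and \<open>c' \<times> t\<close> in the moving frame. That \<open>S\<close> is the
  derivative of the dual arc length is the fundamental theorem of calculus, for which smoothness
  makes \<open>\<Delta>\<close> continuous.
\<close>

section \<open>The dual scalar product\<close>

definition dual_inner :: "(real^3) dual \<Rightarrow> (real^3) dual \<Rightarrow> real dual" (infix \<open>\<bullet>\<^sub>D\<close> 70)
  where "x \<bullet>\<^sub>D y = Dual (real_part x \<bullet> real_part y)
    (real_part x \<bullet> dual_part y + dual_part x \<bullet> real_part y)"

lemma dual_inner_diff_right: "x \<bullet>\<^sub>D (y - z) = x \<bullet>\<^sub>D y - x \<bullet>\<^sub>D z"
  by (simp add: dual_inner_def minus_dual_def inner_diff_right)

lemma dual_inner_diff_left: "(x - y) \<bullet>\<^sub>D z = x \<bullet>\<^sub>D z - y \<bullet>\<^sub>D z"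
  by (simp add: dual_inner_def minus_dual_def inner_diff_left)

lemma dual_inner_scale_right: "x \<bullet>\<^sub>D (a *\<^sub>D y) = a * (x \<bullet>\<^sub>D y)"
  by (simp add: dual_inner_def dual_scale_def times_dual_def inner_add_right algebra_simps)

lemma dual_inner_scale_left: "(a *\<^sub>D x) \<bullet>\<^sub>D y = a * (x \<bullet>\<^sub>D y)"
  by (simp add: dual_inner_def dual_scale_def times_dual_def inner_add_left algebra_simps)

text \<open>The dual parts cancel because the triple product \<open>x \<bullet> (p \<times> y)\<close> is antisymmetric in \<open>x\<close> and
  \<open>y\<close>; hence lines through a common point inherit all scalar products from their directions.\<close>

lemma dual_inner_dual_line: "dual_line p x \<bullet>\<^sub>D dual_line p y = Dual (x \<bullet> y) 0"
  by (simp add: dual_inner_def dual_line_def)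
    (metis cross_triple cross_skew inner_commute inner_minus_right add.right_inverse)

lemma norm_real_part_le: "norm (real_part x) \<le> norm x"
  and norm_dual_part_le: "norm (dual_part x) \<le> norm x"
  by (simp_all add: norm_dual_def norm_Pair)

lemma norm_Dual_le: "norm (Dual a b) \<le> norm a + norm b"
  by (simp add: norm_dual_def norm_Pair_le)

text \<open>Boundedness makes the product rule for vector derivatives available for \<open>\<bullet>\<^sub>D\<close>.\<close>

lemma bounded_bilinear_dual_inner: "bounded_bilinear dual_inner"
proof
  fix a b c d :: "(real^3) dual" and r :: real
  show "(a + b) \<bullet>\<^sub>D c = a \<bullet>\<^sub>D c + b \<bullet>\<^sub>D c" "a \<bullet>\<^sub>D (b + c) = a \<bullet>\<^sub>D b + a \<bullet>\<^sub>D c"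
    by (simp_all add: dual_inner_def plus_dual_def inner_add_left inner_add_right)
  show "(r *\<^sub>R a) \<bullet>\<^sub>D b = r *\<^sub>R (a \<bullet>\<^sub>D b)" "a \<bullet>\<^sub>D (r *\<^sub>R b) = r *\<^sub>R (a \<bullet>\<^sub>D b)"
    by (simp_all add: dual_inner_def scaleR_dual_def algebra_simps)
  have "norm (a \<bullet>\<^sub>D b) \<le> norm a * norm b * 3" for a b
  proof -
    have *: "\<bar>u \<bullet> v\<bar> \<le> norm a * norm b" if "norm u \<le> norm a" "norm v \<le> norm b" for u v :: "real^3"
      by (rule order_trans[OF Cauchy_Schwarz_ineq2]) (intro mult_mono that norm_ge_zero)
    show ?thesis
      using norm_Dual_le[of "real_part a \<bullet> real_part b"
          "real_part a \<bullet> dual_part b + dual_part a \<bullet> real_part b"]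
        *[of "real_part a" "real_part b"] *[of "real_part a" "dual_part b"]
        *[of "dual_part a" "real_part b"]
      by (simp add: dual_inner_def norm_real_part_le norm_dual_part_le)
  qed
  then show "\<exists>K. \<forall>a b. norm (a \<bullet>\<^sub>D b) \<le> norm a * norm b * K"
    by blast
qed

lemma has_vector_derivative_Dual:
  assumes "(f has_vector_derivative f') (at s)" "(g has_vector_derivative g') (at s)"
  shows "((\<lambda>u. Dual (f u) (g u)) has_vector_derivative Dual f' g') (at s)"
proof -
  have "bounded_linear (\<lambda>p :: 'a \<times> 'a. Dual (fst p) (snd p))"
    by (rule bounded_linear_intro[where K = 1])
      (simp_all add: plus_dual_def scaleR_dual_def norm_dual_def)
  from bounded_linear.has_vector_derivative[OF this has_vector_derivative_Pair[OF assms]]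
  show ?thesis by simp
qed

section \<open>The dual Darboux frame\<close>

lemma smooth_on_has_vector_derivative:
  assumes "smooth_on I f" "s \<in> I"
  shows "(f has_vector_derivative vector_derivative f (at s)) (at s)"
proof -
  have "((\<lambda>h u. vector_derivative h (at u)) ^^ 0) f differentiable at s"
    using assms unfolding smooth_on_def by blast
  then show ?thesis by (simp add: vector_derivative_works)
qed

lemma smooth_on_continuous_vector_derivative:
  assumes "smooth_on I f"
  shows "continuous_on I (\<lambda>s. vector_derivative f (at s))"
proof -
  have "((\<lambda>h u. vector_derivative h (at u)) ^^ 1) f differentiable at s" if "s \<in> I" for s
    using assms that unfolding smooth_on_def by blast
  then show ?thesis
    by (intro continuous_at_imp_continuous_on)
      (auto intro: differentiable_imp_continuous_within)
qed

lemma ruled_surface_orthogonal: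
  assumes "ruled_surface I \<phi> c e" "s \<in> I"
  shows "e s \<bullet> tvec e s = 0"
proof -
  have e: "(e has_vector_derivative tvec e s) (at s)"
    using assms smooth_on_has_vector_derivative by (auto simp: ruled_surface_def tvec_def)
  have "((\<lambda>u. e u \<bullet> e u) has_vector_derivative e s \<bullet> tvec e s + tvec e s \<bullet> e s) (at s)"
    by (rule bounded_bilinear.has_vector_derivative[OF bounded_bilinear_inner e e])
  moreover have "((\<lambda>u. e u \<bullet> e u) has_vector_derivative 0) (at s)"
    by (rule has_vector_derivative_transform_within_open[OF has_vector_derivative_const[of 1]])
      (use assms in \<open>auto simp: ruled_surface_def\<close>)
  ultimately show ?thesis
    using vector_derivative_unique_at by (fastforce simp: inner_commute)
qed

lemma dual_frame_inner:
  assumes "ruled_surface I \<phi> c e" "s \<in> I"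
  shows "dual_e c e s \<bullet>\<^sub>D dual_e c e s = 1" "dual_t c e s \<bullet>\<^sub>D dual_t c e s = 1"
    "dual_g c e s \<bullet>\<^sub>D dual_g c e s = 1" "dual_e c e s \<bullet>\<^sub>D dual_t c e s = 0"
    "dual_e c e s \<bullet>\<^sub>D dual_g c e s = 0" "dual_g c e s \<bullet>\<^sub>D dual_e c e s = 0"
proof -
  have "e s \<bullet> e s = 1" "tvec e s \<bullet> tvec e s = 1"
    using assms by (auto simp: ruled_surface_def tvec_def)
  moreover note ruled_surface_orthogonal[OF assms]
  moreover have "gvec e s \<bullet> gvec e s = (e s \<bullet> e s) * (tvec e s \<bullet> tvec e s) - (e s \<bullet> tvec e s)\<^sup>2"
    by (simp add: gvec_def dot_cross power2_eq_square inner_commute)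
  ultimately show "dual_e c e s \<bullet>\<^sub>D dual_e c e s = 1" "dual_t c e s \<bullet>\<^sub>D dual_t c e s = 1"
    "dual_g c e s \<bullet>\<^sub>D dual_g c e s = 1" "dual_e c e s \<bullet>\<^sub>D dual_t c e s = 0"
    "dual_e c e s \<bullet>\<^sub>D dual_g c e s = 0" "dual_g c e s \<bullet>\<^sub>D dual_e c e s = 0"
    by (simp_all add: dual_e_def dual_t_def dual_g_def dual_inner_dual_line one_dual_def
        zero_dual_def gvec_def dot_cross_self)
qed

text \<open>The striction condition removes the \<open>t\<close>-component of \<open>c'\<close>, leaving \<open>c' = \<delta> e + \<Delta> g\<close>. Both
  products are then read off from the double cross product formula, after writing \<open>e = t \<times> g\<close> and
  \<open>t = g \<times> e\<close>.\<close>

lemma striction_derivative_cross: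
  assumes "ruled_surface I \<phi> c e" "s \<in> I"
  shows "vector_derivative c (at s) \<times> e s = Delta c e s *\<^sub>R tvec e s"
    and "vector_derivative c (at s) \<times> tvec e s = delta c e s *\<^sub>R gvec e s - Delta c e s *\<^sub>R e s"
proof -
  let ?c = "vector_derivative c (at s)"
  have unit: "e s \<bullet> e s = 1" "tvec e s \<bullet> tvec e s = 1" and striction: "?c \<bullet> tvec e s = 0"
    using assms by (auto simp: ruled_surface_def tvec_def)
  note orth = ruled_surface_orthogonal[OF assms]
  have Delta: "?c \<bullet> gvec e s = Delta c e s"
    by (simp add: Delta_def gvec_def dot_cross_det)
  have "e s = tvec e s \<times> gvec e s"
    using unit orth by (simp add: gvec_def Lagrange inner_commute)
  then have "?c \<times> e s = ?c \<times> (tvec e s \<times> gvec e s)" by simp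
  then show "?c \<times> e s = Delta c e s *\<^sub>R tvec e s"
    by (simp add: Lagrange Delta striction)
  have "e s \<times> gvec e s = - tvec e s"
    using unit orth by (simp add: gvec_def Lagrange)
  then have "tvec e s = gvec e s \<times> e s"
    using cross_skew[of "gvec e s" "e s"] by simp
  then have "?c \<times> tvec e s = ?c \<times> (gvec e s \<times> e s)" by simp
  then show "?c \<times> tvec e s = delta c e s *\<^sub>R gvec e s - Delta c e s *\<^sub>R e s"
    by (simp add: Lagrange Delta delta_def)
qed

lemma has_vector_derivative_dual_line:
  assumes "(p has_vector_derivative p') (at s)" "(x has_vector_derivative x') (at s)"
  shows "((\<lambda>u. dual_line (p u) (x u)) has_vector_derivative
    Dual x' (p s \<times> x' + p' \<times> x s)) (at s)"
  unfolding dual_line_def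
  by (intro has_vector_derivative_Dual assms
      bounded_bilinear.has_vector_derivative[OF bilinear_conv_bounded_bilinear[THEN iffD1, OF bilinear_cross]])

lemma has_vector_derivative_dual_e:
  assumes "ruled_surface I \<phi> c e" "s \<in> I"
  shows "(dual_e c e has_vector_derivative Dual 1 (Delta c e s) *\<^sub>D dual_t c e s) (at s)"
proof -
  have "(c has_vector_derivative vector_derivative c (at s)) (at s)"
    "(e has_vector_derivative tvec e s) (at s)"
    using assms smooth_on_has_vector_derivative by (auto simp: ruled_surface_def tvec_def)
  from has_vector_derivative_dual_line[OF this] show ?thesis
    by (simp add: dual_e_def[abs_def] dual_t_def dual_scale_def dual_line_def
        striction_derivative_cross[OF assms])
qed

lemma has_vector_derivative_dual_t:
  assumes "ruled_surface I \<phi> c e" "conical_curvature I e \<gamma>" "s \<in> I"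
  shows "(dual_t c e has_vector_derivative Dual 1 (Delta c e s) *\<^sub>D
    (dual_conical_curvature c e \<gamma> s *\<^sub>D dual_g c e s - dual_e c e s)) (at s)"
proof -
  have c: "(c has_vector_derivative vector_derivative c (at s)) (at s)"
    using assms smooth_on_has_vector_derivative by (auto simp: ruled_surface_def)
  have t: "(tvec e has_vector_derivative \<gamma> s *\<^sub>R gvec e s - e s) (at s)"
    using assms by (auto simp: conical_curvature_def)
  \<comment> \<open>The correction \<open>- \<gamma> \<Delta>\<close> in the dual conical curvature compensates the factor \<open>1 + \<epsilon> \<Delta>\<close>.\<close>
  have "Dual (\<gamma> s *\<^sub>R gvec e s - e s)
      (c s \<times> (\<gamma> s *\<^sub>R gvec e s - e s) + vector_derivative c (at s) \<times> tvec e s) =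
    Dual 1 (Delta c e s) *\<^sub>D (dual_conical_curvature c e \<gamma> s *\<^sub>D dual_g c e s - dual_e c e s)"
    by (simp add: dual_conical_curvature_def dual_scale_def dual_g_def dual_e_def dual_line_def
        minus_dual_def striction_derivative_cross[OF assms(1,3)] Cross3.right_diff_distrib cross_mult_right
        algebra_simps)
  with has_vector_derivative_dual_line[OF c t] show ?thesis
    by (simp add: dual_t_def[abs_def])
qed

section \<open>The dual arc length\<close>

lemma continuous_on_Delta:
  assumes "ruled_surface I \<phi> c e"
  shows "continuous_on I (Delta c e)"
proof -
  have smooth: "smooth_on I c" "smooth_on I e"
    using assms by (auto simp: ruled_surface_def)
  have "continuous_on I e"
    using smooth_on_has_vector_derivative[OF smooth(2)]
    by (intro continuous_at_imp_continuous_on) (auto intro: has_vector_derivative_continuous)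
  moreover note smooth[THEN smooth_on_continuous_vector_derivative]
  ultimately have "continuous_on I (\<lambda>s. vector_derivative c (at s) \<bullet> (e s \<times> tvec e s))"
    unfolding tvec_def by (intro continuous_intros continuous_on_cross)
  then show ?thesis
    by (simp add: Delta_def[abs_def] dot_cross_det)
qed

lemma has_vector_derivative_dual_arc_length:
  assumes "ruled_surface I \<phi> c e" "s \<in> I"
  shows "(dual_arc_length c e has_vector_derivative Dual 1 (Delta c e s)) (at s)"
proof -
  have I: "open I" "is_interval I" "0 \<in> I"
    using assms by (auto simp: ruled_surface_def)
  obtain r where r: "r > 0" "cball s r \<subseteq> I"
    using open_contains_cball_eq[OF I(1)] assms(2) by blast
  \<comment> \<open>A compact interval inside \<open>I\<close> containing the base point, with \<open>s\<close> in its interior.\<close>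
  define a b where "a = min 0 (s - r)" and "b = max 0 (s + r)"
  have "s - r \<in> I" "s + r \<in> I"
    using r by (auto intro!: subsetD[OF r(2)] simp: dist_real_def)
  then have "a \<in> I" "b \<in> I"
    using I(3) by (auto simp: a_def b_def min_def max_def)
  then have "{a..b} \<subseteq> I"
    using mem_is_interval_1_I[OF I(2)] by (meson atLeastAtMost_iff subsetI)
  then have cont: "continuous_on {a..b} (Delta c e)"
    using continuous_on_Delta[OF assms(1)] continuous_on_subset by blast
  have s: "s \<in> {a<..<b}" and ab: "a \<le> 0" "0 \<le> b"
    using r(1) by (auto simp: a_def b_def)
  have "((\<lambda>u. LBINT y=ereal 0..ereal u. Delta c e y) has_vector_derivative Delta c e s)
    (at s within {a..b})"
    by (rule interval_integral_FTC2[OF ab cont]) (use s in simp_all)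
  then have "((\<lambda>u. LBINT y=ereal 0..ereal u. Delta c e y) has_vector_derivative Delta c e s) (at s)"
    using s at_within_interior[of s "{a..b}"] by simp
  then show ?thesis
    unfolding dual_arc_length_def[abs_def]
    by (intro has_vector_derivative_Dual has_vector_derivative_id)
qed

section \<open>Bertrand offsets\<close>

theorem theorem4p2:
  fixes I I\<^sub>1 :: "real set"
    and \<phi> \<phi>\<^sub>1 :: "real \<Rightarrow> real \<Rightarrow> real^3"
    and c e c\<^sub>1 e\<^sub>1 :: "real \<Rightarrow> real^3"
    and \<sigma> \<gamma> :: "real \<Rightarrow> real"
    and \<theta> :: "real \<Rightarrow> real dual"
    and s :: real
  assumes "ruled_surface I \<phi> c e"
    and "ruled_surface I\<^sub>1 \<phi>\<^sub>1 c\<^sub>1 e\<^sub>1"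
    and "bertrand_offset I c e I\<^sub>1 c\<^sub>1 e\<^sub>1 \<sigma>"
    and "dual_offset_angle I c e c\<^sub>1 e\<^sub>1 \<sigma> \<theta>"
    and "conical_curvature I e \<gamma>"
    and "s \<in> I"
  shows "has_derivative_wrt (\<lambda>u. dual_arc_length c\<^sub>1 e\<^sub>1 (\<sigma> u)) (dual_arc_length c e)
    (dcos (\<theta> s) + dual_conical_curvature c e \<gamma> s * dsin (\<theta> s)) s"
proof -
  have \<sigma>_mem: "\<sigma> u \<in> I\<^sub>1" and t\<^sub>1: "dual_t c\<^sub>1 e\<^sub>1 (\<sigma> u) = dual_t c e u" if "u \<in> I" for u
    using assms(3) that by (auto simp: bertrand_offset_def bij_betw_def)
  obtain d where d: "(\<sigma> has_vector_derivative d) (at s)"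
    using assms(3,6) by (auto simp: bertrand_offset_def has_real_derivative_iff_has_vector_derivative)
  define S where "S = Dual 1 (Delta c e s)"
  define S\<^sub>1 where "S\<^sub>1 = d *\<^sub>R Dual 1 (Delta c\<^sub>1 e\<^sub>1 (\<sigma> s))"
  define \<kappa> where "\<kappa> = dual_conical_curvature c e \<gamma> s"
  let ?e\<^sub>1 = "\<lambda>u. dual_e c\<^sub>1 e\<^sub>1 (\<sigma> u)"
  have deriv_S: "(dual_arc_length c e has_vector_derivative S) (at s)"
    unfolding S_def by (rule has_vector_derivative_dual_arc_length[OF assms(1,6)])
  have deriv_S\<^sub>1: "((\<lambda>u. dual_arc_length c\<^sub>1 e\<^sub>1 (\<sigma> u)) has_vector_derivative S\<^sub>1) (at s)"
    using vector_diff_chain_at[OF d has_vector_derivative_dual_arc_length[OF assms(2) \<sigma>_mem[OF assms(6)]]]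
    by (simp add: S\<^sub>1_def o_def)
  have deriv_e\<^sub>1: "(?e\<^sub>1 has_vector_derivative S\<^sub>1 *\<^sub>D dual_t c e s) (at s)"
  proof -
    have "d *\<^sub>R (Dual 1 (Delta c\<^sub>1 e\<^sub>1 (\<sigma> s)) *\<^sub>D dual_t c\<^sub>1 e\<^sub>1 (\<sigma> s)) = S\<^sub>1 *\<^sub>D dual_t c e s"
      by (simp add: S\<^sub>1_def t\<^sub>1[OF assms(6)] dual_scale_def scaleR_dual_def algebra_simps)
    with vector_diff_chain_at[OF d has_vector_derivative_dual_e[OF assms(2) \<sigma>_mem[OF assms(6)]]]
    show ?thesis by (simp add: o_def)
  qed
  have "((\<lambda>u. ?e\<^sub>1 u \<bullet>\<^sub>D dual_t c e u) has_vector_derivative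
    ?e\<^sub>1 s \<bullet>\<^sub>D (S *\<^sub>D (\<kappa> *\<^sub>D dual_g c e s - dual_e c e s)) + (S\<^sub>1 *\<^sub>D dual_t c e s) \<bullet>\<^sub>D dual_t c e s) (at s)"
    unfolding S_def \<kappa>_def
    by (rule bounded_bilinear.has_vector_derivative[OF bounded_bilinear_dual_inner deriv_e\<^sub>1
          has_vector_derivative_dual_t[OF assms(1,5,6)]])
  moreover have "((\<lambda>u. ?e\<^sub>1 u \<bullet>\<^sub>D dual_t c e u) has_vector_derivative 0) (at s)"
  proof (rule has_vector_derivative_transform_within_open[OF has_vector_derivative_const[of 0]])
    show "open I" "s \<in> I"
      using assms(1,6) by (auto simp: ruled_surface_def)
    show "0 = ?e\<^sub>1 u \<bullet>\<^sub>D dual_t c e u" if "u \<in> I" for u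
      using dual_frame_inner(4)[OF assms(2) \<sigma>_mem[OF that]] by (simp add: t\<^sub>1[OF that])
  qed
  ultimately have "?e\<^sub>1 s \<bullet>\<^sub>D (S *\<^sub>D (\<kappa> *\<^sub>D dual_g c e s - dual_e c e s)) +
      (S\<^sub>1 *\<^sub>D dual_t c e s) \<bullet>\<^sub>D dual_t c e s = 0"
    by (rule vector_derivative_unique_at)
  moreover have "?e\<^sub>1 s = dcos (\<theta> s) *\<^sub>D dual_e c e s - dsin (\<theta> s) *\<^sub>D dual_g c e s"
    using assms(4,6) by (simp add: dual_offset_angle_def)
  ultimately have "S * (\<kappa> * (- dsin (\<theta> s)) - dcos (\<theta> s)) + S\<^sub>1 = 0"
    by (simp add: dual_inner_scale_left dual_inner_scale_right dual_inner_diff_left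
        dual_inner_diff_right dual_frame_inner[OF assms(1,6)])
  then have S\<^sub>1: "S\<^sub>1 = (dcos (\<theta> s) + \<kappa> * dsin (\<theta> s)) * S"
    by (simp add: algebra_simps add_eq_0_iff)
  have "real_part S \<noteq> 0"
    by (simp add: S_def)
  then have "S\<^sub>1 / S = dcos (\<theta> s) + \<kappa> * dsin (\<theta> s)"
    by (simp add: S\<^sub>1 divide_dual_def mult.assoc dual_mult_inverse)
  with deriv_S deriv_S\<^sub>1 \<open>real_part S \<noteq> 0\<close> show ?thesis
    unfolding has_derivative_wrt_def \<kappa>_def by blast
qed

end
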